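(* Let $\varepsilon>0$ and let $[x,y_1,y_2,z]^T\in\mathbb{R}^4$ with $[x,y_1,y_2,z]^T\notin G^\varepsilon$ and $|y_1|\ge|y_2|$. If $y_1\neq0$, put $a=1+y_2^2/y_1^2$. Let $C\subset\mathbb{R}^4$ be the set consisting exactly of the following candidate points $[\rho,m_1,m_2,E]^T$: 1. $[\varepsilon,y_1,y_2,z]^T$, if $x<\varepsilon$ and $z-\frac{1}{2\varepsilon}(y_1^2+y_2^2)\ge\varepsilon$. 2. $[\varepsilon,0,0,\varepsilon]^T$, if $x<\varepsilon$, $y_1=0$, $y_2=0$ and $z<\varepsilon$. 3. If $y_1\ne0$: for each real root $m_{1r}$ of the cubic equation $a m_1^3+(4\varepsilon^2-2\varepsilon z)m_1-2\varepsilon^2y_1=0$, the point $\big[\varepsilon,\,m_{1r},\,\frac{y_2}{y_1}m_{1r},\,\frac{a}{2\varepsilon}m_{1r}^2+\varepsilon\big]^T$, provided $\frac{y_1}{m_{1r}}>1$ and $2\varepsilon x+a\,m_{1r}(y_1-m_{1r})<2\varepsilon^2$. 4. $[x,0,0,\varepsilon]^T$, if $x\ge\varepsilon$, $y_1=0$, $y_2=0$ and $z<\varepsilon$. 5. If $y_1\neq 0$: for each of the two values $$\rho_1,\rho_2=\frac{x}{2}\pm\frac12\,\frac{\sqrt{x^2\big(2y_1^2+\frac1a(\varepsilon+x-z)^2\big)-2xy_1^2(z-\varepsilon)+a y_1^4}}{\sqrt{2y_1^2+\frac1a(\varepsilon+x-z)^2}}$$ (considered only if real), and for each of the two values $$m_{1\alpha}(\rho_j),\,m_{1\beta}(\rho_j)=\frac{y_1}{2}\mp\frac{1}{2a}\sqrt{-8a\rho_j^2+8ax\rho_j+a^2y_1^2}$$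 (considered only if real), the point $\big[\rho_j,\ m_{1s}(\rho_j),\ \frac{y_2}{y_1}m_{1s}(\rho_j),\ \varepsilon+a\frac{m_{1s}(\rho_j)^2}{2\rho_j}\big]^T$ ($j\in\{1,2\}$, $s\in\{\alpha,\beta\}$), provided $\rho_j\ge\varepsilon$ and $\varepsilon+a\frac{m_{1s}(\rho_j)^2}{2\rho_j}>z$. Then there is a point of $C$ minimizing $|\rho-x|^2+|m_1-y_1|^2+|m_2-y_2|^2+|E-z|^2$ over all $[\rho,m_1,m_2,E]^T\in C$, and such a point is the Euclidean projection of $[x,y_1,y_2,z]^T$ onto $G^\varepsilon$.
   Context: Here $G^\varepsilon=\{[\rho,m_1,m_2,E]^T\in\mathbb{R}^4:\ \rho\ge\varepsilon,\ E-\frac{m_1^2+m_2^2}{2\rho}\ge\varepsilon\}$, a closed convex set. The Euclidean projection of a point onto $G^\varepsilon$ is the unique point of $G^\varepsilon$ at minimal Euclidean distance from it. *)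

theory Defs
  imports "HOL-Analysis.Analysis"
begin

text \<open>
  Points \<open>[\<rho>, m1, m2, E]\<close> are vectors \<open>p :: real ^ 4\<close> with \<open>\<rho> = p $ 1\<close>, \<open>m1 = p $ 2\<close>, \<open>m2 = p $ 3\<close>
  and \<open>E = p $ 4\<close>. The Euclidean projection onto the set below is the library function
  \<open>closest_point\<close>; as that is defined by Hilbert choice, the theorem
  \<open>closest_point_Geps_iff\<close> confirms that it is the unique point at minimal distance.
\<close>

definition Geps :: "real \<Rightarrow> (real ^ 4) set" where
  "Geps \<epsilon> = {p. p $ 1 \<ge> \<epsilon> \<and> p $ 4 - ((p $ 2)\<^sup>2 + (p $ 3)\<^sup>2) / (2 * p $ 1) \<ge> \<epsilon>}"

definition coef_a :: "real \<Rightarrow> real \<Rightarrow> real" where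
  "coef_a y1 y2 = 1 + y2\<^sup>2 / y1\<^sup>2"

definition cand1 :: "real \<Rightarrow> real \<Rightarrow> real \<Rightarrow> real \<Rightarrow> real \<Rightarrow> (real ^ 4) set" where
  "cand1 \<epsilon> x y1 y2 z =
     {p. p = vector [\<epsilon>, y1, y2, z] \<and> x < \<epsilon> \<and> z - 1 / (2 * \<epsilon>) * (y1\<^sup>2 + y2\<^sup>2) \<ge> \<epsilon>}"

definition cand2 :: "real \<Rightarrow> real \<Rightarrow> real \<Rightarrow> real \<Rightarrow> real \<Rightarrow> (real ^ 4) set" where
  "cand2 \<epsilon> x y1 y2 z =
     {p. p = vector [\<epsilon>, 0, 0, \<epsilon>] \<and> x < \<epsilon> \<and> y1 = 0 \<and> y2 = 0 \<and> z < \<epsilon>}"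

definition cand3 :: "real \<Rightarrow> real \<Rightarrow> real \<Rightarrow> real \<Rightarrow> real \<Rightarrow> (real ^ 4) set" where
  "cand3 \<epsilon> x y1 y2 z = (let a = coef_a y1 y2 in
     {vector [\<epsilon>, m, y2 / y1 * m, a / (2 * \<epsilon>) * m\<^sup>2 + \<epsilon>] | m.
        y1 \<noteq> 0 \<and>
        a * m ^ 3 + (4 * \<epsilon>\<^sup>2 - 2 * \<epsilon> * z) * m - 2 * \<epsilon>\<^sup>2 * y1 = 0 \<and>
        y1 / m > 1 \<and> 2 * \<epsilon> * x + a * m * (y1 - m) < 2 * \<epsilon>\<^sup>2})"

definition cand4 :: "real \<Rightarrow> real \<Rightarrow> real \<Rightarrow> real \<Rightarrow> real \<Rightarrow> (real ^ 4) set" where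
  "cand4 \<epsilon> x y1 y2 z =
     {p. p = vector [x, 0, 0, \<epsilon>] \<and> x \<ge> \<epsilon> \<and> y1 = 0 \<and> y2 = 0 \<and> z < \<epsilon>}"

text \<open>
  Since \<open>sqrt\<close> is total on the reals, the restriction to real values is stated as nonnegativity
  of the radicands. The radicand \<open>S\<close> of the denominator is positive whenever \<open>y1 \<noteq> 0\<close>.
\<close>

definition rho_values :: "real \<Rightarrow> real \<Rightarrow> real \<Rightarrow> real \<Rightarrow> real \<Rightarrow> real set" where
  "rho_values \<epsilon> x y1 y2 z = (let
       a = coef_a y1 y2;
       S = 2 * y1\<^sup>2 + 1 / a * (\<epsilon> + x - z)\<^sup>2;
       R = x\<^sup>2 * S - 2 * x * y1\<^sup>2 * (z - \<epsilon>) + a * y1 ^ 4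
     in {\<rho>. R \<ge> 0 \<and>
           (\<rho> = x / 2 + 1 / 2 * (sqrt R / sqrt S) \<or> \<rho> = x / 2 - 1 / 2 * (sqrt R / sqrt S))})"

definition m1_values :: "real \<Rightarrow> real \<Rightarrow> real \<Rightarrow> real \<Rightarrow> real set" where
  "m1_values x y1 y2 \<rho> = (let
       a = coef_a y1 y2;
       D = - 8 * a * \<rho>\<^sup>2 + 8 * a * x * \<rho> + a\<^sup>2 * y1\<^sup>2
     in {m. D \<ge> 0 \<and>
           (m = y1 / 2 - 1 / (2 * a) * sqrt D \<or> m = y1 / 2 + 1 / (2 * a) * sqrt D)})"

definition cand5 :: "real \<Rightarrow> real \<Rightarrow> real \<Rightarrow> real \<Rightarrow> real \<Rightarrow> (real ^ 4) set" where
  "cand5 \<epsilon> x y1 y2 z = (let a = coef_a y1 y2 in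
     {vector [\<rho>, m, y2 / y1 * m, \<epsilon> + a * (m\<^sup>2 / (2 * \<rho>))] | \<rho> m.
        y1 \<noteq> 0 \<and>
        \<rho> \<in> rho_values \<epsilon> x y1 y2 z \<and> m \<in> m1_values x y1 y2 \<rho> \<and>
        \<rho> \<ge> \<epsilon> \<and> \<epsilon> + a * (m\<^sup>2 / (2 * \<rho>)) > z})"

definition candidates :: "real \<Rightarrow> real \<Rightarrow> real \<Rightarrow> real \<Rightarrow> real \<Rightarrow> (real ^ 4) set" where
  "candidates \<epsilon> x y1 y2 z =
     cand1 \<epsilon> x y1 y2 z \<union> cand2 \<epsilon> x y1 y2 z \<union> cand3 \<epsilon> x y1 y2 z \<union>
     cand4 \<epsilon> x y1 y2 z \<union> cand5 \<epsilon> x y1 y2 z"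

lemma vector_4_nth [simp]:
  fixes a b c d :: real
  shows "(vector [a, b, c, d] :: real ^ 4) $ 1 = a"
    and "(vector [a, b, c, d] :: real ^ 4) $ 2 = b"
    and "(vector [a, b, c, d] :: real ^ 4) $ 3 = c"
    and "(vector [a, b, c, d] :: real ^ 4) $ 4 = d"
  unfolding vector_def by simp_all

lemma Geps_alt:
  assumes "\<epsilon> > 0"
  shows "Geps \<epsilon> = {p. \<epsilon> \<le> p $ 1 \<and> (p $ 2)\<^sup>2 + (p $ 3)\<^sup>2 \<le> 2 * p $ 1 * (p $ 4 - \<epsilon>)}"
proof -
  have "p $ 4 - ((p $ 2)\<^sup>2 + (p $ 3)\<^sup>2) / (2 * p $ 1) \<ge> \<epsilon>
        \<longleftrightarrow> (p $ 2)\<^sup>2 + (p $ 3)\<^sup>2 \<le> 2 * p $ 1 * (p $ 4 - \<epsilon>)"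
    if "\<epsilon> \<le> p $ 1" for p :: "real ^ 4"
  proof -
    have "2 * p $ 1 > 0" using that assms by simp
    then have "((p $ 2)\<^sup>2 + (p $ 3)\<^sup>2) / (2 * p $ 1) \<le> p $ 4 - \<epsilon>
        \<longleftrightarrow> (p $ 2)\<^sup>2 + (p $ 3)\<^sup>2 \<le> (p $ 4 - \<epsilon>) * (2 * p $ 1)"
      by (rule pos_divide_le_eq)
    then show ?thesis by (simp add: mult.commute) linarith
  qed
  then show ?thesis unfolding Geps_def by blast
qed

lemma closed_Geps:
  assumes "\<epsilon> > 0"
  shows "closed (Geps \<epsilon>)"
  unfolding Geps_alt[OF assms]
  by (intro closed_Collect_conj closed_Collect_le continuous_intros)

lemma Geps_cross:
  fixes r s e f b c d h :: real
  assumes "r > 0" "s > 0" "b\<^sup>2 + c\<^sup>2 \<le> 2 * r * e" "d\<^sup>2 + h\<^sup>2 \<le> 2 * s * f"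
  shows "b * d + c * h \<le> r * f + s * e"
proof -
  have "0 \<le> (s * b - r * d)\<^sup>2 + (s * c - r * h)\<^sup>2" by simp
  also have "\<dots> = s\<^sup>2 * (b\<^sup>2 + c\<^sup>2) + r\<^sup>2 * (d\<^sup>2 + h\<^sup>2) - 2 * (r * s) * (b * d + c * h)"
    by (simp add: algebra_simps power2_eq_square)
  also have "\<dots> \<le> s\<^sup>2 * (2 * r * e) + r\<^sup>2 * (2 * s * f) - 2 * (r * s) * (b * d + c * h)"
    using assms by (intro diff_right_mono add_mono mult_left_mono) auto
  also have "\<dots> = 2 * (r * s) * (r * f + s * e - (b * d + c * h))"
    by (simp add: algebra_simps power2_eq_square)
  finally have "0 \<le> 2 * (r * s) * (r * f + s * e - (b * d + c * h))" .
  moreover have "2 * (r * s) > 0" using assms by simp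
  ultimately have "0 \<le> r * f + s * e - (b * d + c * h)"
    by (meson linorder_not_le mult_pos_neg)
  then show ?thesis by simp
qed

lemma convex_Geps:
  assumes "\<epsilon> > 0"
  shows "convex (Geps \<epsilon>)"
proof (rule convexI)
  fix p q :: "real ^ 4" and u v :: real
  assume p: "p \<in> Geps \<epsilon>" and q: "q \<in> Geps \<epsilon>" and uv: "0 \<le> u" "0 \<le> v" "u + v = 1"
  let ?w = "u *\<^sub>R p + v *\<^sub>R q"
  have P: "\<epsilon> \<le> p $ 1" "(p $ 2)\<^sup>2 + (p $ 3)\<^sup>2 \<le> 2 * p $ 1 * (p $ 4 - \<epsilon>)"
    and Q: "\<epsilon> \<le> q $ 1" "(q $ 2)\<^sup>2 + (q $ 3)\<^sup>2 \<le> 2 * q $ 1 * (q $ 4 - \<epsilon>)"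
    using p q by (auto simp: Geps_alt[OF assms])
  have cross: "p $ 2 * q $ 2 + p $ 3 * q $ 3 \<le> p $ 1 * (q $ 4 - \<epsilon>) + q $ 1 * (p $ 4 - \<epsilon>)"
    using P Q assms by (intro Geps_cross) auto
  have "u * \<epsilon> + v * \<epsilon> \<le> u * p $ 1 + v * q $ 1"
    using P Q uv by (intro add_mono mult_left_mono) auto
  then have 1: "\<epsilon> \<le> ?w $ 1" using uv by (simp flip: distrib_right)
  have "(?w $ 2)\<^sup>2 + (?w $ 3)\<^sup>2 = u\<^sup>2 * ((p $ 2)\<^sup>2 + (p $ 3)\<^sup>2) + v\<^sup>2 * ((q $ 2)\<^sup>2 + (q $ 3)\<^sup>2)
      + 2 * u * v * (p $ 2 * q $ 2 + p $ 3 * q $ 3)"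
    by (simp add: algebra_simps power2_eq_square)
  also have "\<dots> \<le> u\<^sup>2 * (2 * p $ 1 * (p $ 4 - \<epsilon>)) + v\<^sup>2 * (2 * q $ 1 * (q $ 4 - \<epsilon>))
      + 2 * u * v * (p $ 1 * (q $ 4 - \<epsilon>) + q $ 1 * (p $ 4 - \<epsilon>))"
    using P Q uv by (intro add_mono mult_left_mono[OF cross] mult_left_mono[OF P(2)]
        mult_left_mono[OF Q(2)]) auto
  also have "\<dots> = 2 * (u * p $ 1 + v * q $ 1) * (u * (p $ 4 - \<epsilon>) + v * (q $ 4 - \<epsilon>))"
    by (simp add: algebra_simps power2_eq_square)
  also have "u * (p $ 4 - \<epsilon>) + v * (q $ 4 - \<epsilon>) = ?w $ 4 - (u + v) * \<epsilon>"
    by (simp add: algebra_simps)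
  finally have 2: "(?w $ 2)\<^sup>2 + (?w $ 3)\<^sup>2 \<le> 2 * ?w $ 1 * (?w $ 4 - \<epsilon>)"
    using uv by simp
  show "?w \<in> Geps \<epsilon>" using 1 2 by (simp add: Geps_alt[OF assms])
qed

lemma Geps_nonempty: "Geps \<epsilon> \<noteq> {}"
proof -
  have "(vector [\<epsilon>, 0, 0, \<epsilon>] :: real ^ 4) \<in> Geps \<epsilon>" by (simp add: Geps_def)
  then show ?thesis by blast
qed

theorem closest_point_Geps_iff:
  assumes "\<epsilon> > 0"
  shows "p = closest_point (Geps \<epsilon>) w \<longleftrightarrow> p \<in> Geps \<epsilon> \<and> (\<forall>q\<in>Geps \<epsilon>. dist w p \<le> dist w q)"
  using closest_point_unique[OF convex_Geps[OF assms] closed_Geps[OF assms]]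
    closest_point_exists[OF closed_Geps[OF assms] Geps_nonempty]
  by metis

end

theory Submission
  imports Defs
begin

text \<open>
  Every candidate lies in \<open>Geps \<epsilon>\<close>, so it suffices that the projection \<open>p = [\<rho>, m1, m2, E]\<close> of
  \<open>w = [x, y1, y2, z]\<close> is itself a candidate: it then minimizes the objective, which is the squared
  distance to \<open>w\<close>, over the candidates, and by uniqueness of the projection nothing else does.

  That \<open>p\<close> is a candidate comes from the Karush-Kuhn-Tucker conditions. With the multiplier
  \<open>\<nu> = E - z\<close> of the energy constraint \<open>E - \<bar>m\<bar>\<^sup>2 / (2\<rho>) \<ge> \<epsilon>\<close> and the (rescaled) multiplier
  \<open>\<mu> = \<rho> (\<rho> - x) - \<nu> \<bar>m\<bar>\<^sup>2 / (2\<rho>)\<close> of the density constraint \<open>\<rho> \<ge> \<epsilon>\<close>, they say that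
  \<open>\<nu>, \<mu> \<ge> 0\<close>, that a multiplier vanishes unless its constraint is active, and that
  \<open>\<rho> (y - m) = \<nu> m\<close>. They are read off from the variational
  inequality \<open>(w - p) \<bullet> (q - p) \<le> 0\<close> for \<open>q\<close> in \<open>Geps \<epsilon>\<close> by moving \<open>q\<close> along curves on which the
  constraints are explicit (lemma \<open>projection_kkt\<close>).

  The candidates are the solutions of these conditions, sorted by the signs of the multipliers.
  If \<open>\<nu> = 0\<close>, only \<open>\<rho>\<close> moves, which is candidate 1. If \<open>\<nu> > 0\<close> and \<open>y = 0\<close>, then \<open>m = 0\<close> and one
  gets candidates 2 and 4. If \<open>\<nu> > 0\<close> and \<open>y \<noteq> 0\<close>, then \<open>m\<close> is a nonzero multiple of \<open>y\<close>, hence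
  \<open>m2 = (y2 / y1) m1\<close> and \<open>\<bar>m\<bar>\<^sup>2 = a m1\<^sup>2\<close>; the case \<open>\<mu> > 0\<close> forces \<open>\<rho> = \<epsilon>\<close> and leaves the cubic
  of candidate 3, and \<open>\<mu> = 0\<close> leaves two equations in \<open>\<rho>\<close> and \<open>m1\<close>. One of these is quadratic in
  \<open>m1\<close>; eliminating \<open>m1\<close> gives the quadratic for \<open>\<rho>\<close> in candidate 5
  (lemma \<open>density_quadratic\<close>).
\<close>

section \<open>The optimality conditions\<close>

lemma inner_real4:
  fixes p q :: "real ^ 4"
  shows "p \<bullet> q = p $ 1 * q $ 1 + p $ 2 * q $ 2 + p $ 3 * q $ 3 + p $ 4 * q $ 4"
  by (simp add: inner_vec_def sum_4)

lemma linear_coeff_zero: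
  fixes A B :: real
  assumes "\<And>t. t * A + t\<^sup>2 * B \<le> 0"
  shows "A = 0"
proof (rule ccontr)
  assume "A \<noteq> 0"
  \<comment> \<open>\<open>t = A / c\<close> is so small that \<open>t * A\<close> outweighs the quadratic term\<close>
  define c where "c = \<bar>B\<bar> + 1"
  have c: "c > 0" "c + B > 0" by (auto simp: c_def)
  have "(A / c) * A + (A / c)\<^sup>2 * B = A\<^sup>2 * (c + B) / c\<^sup>2"
    using c by (simp add: field_simps power2_eq_square)
  also have "\<dots> > 0" using c \<open>A \<noteq> 0\<close> by simp
  finally show False using assms[of "A / c"] by simp
qed

text \<open>
  Each condition comes from one family of competitors. Raising \<open>E\<close>, or lowering it to the boundary,
  gives sign and complementarity of \<open>\<nu>\<close>. Changing \<open>m\<close> while adjusting \<open>E\<close> so that the slack in the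
  energy constraint is unchanged can be done in both directions, which gives \<open>\<rho> (y - m) = \<nu> m\<close>.
  Finally, \<open>Geps \<epsilon>\<close> translated by \<open>-\<epsilon>\<close> in \<open>E\<close> is a cone cut off at \<open>\<rho> = \<epsilon>\<close>, so the competitors
  \<open>(1 + t) [\<rho>, m, E - \<epsilon>]\<close> depend linearly on \<open>t\<close>: outward ones give \<open>\<mu> \<ge> 0\<close>, and the one that
  reaches \<open>\<rho> = \<epsilon>\<close> gives complementarity of \<open>\<mu>\<close>.
\<close>

lemma projection_kkt:
  fixes \<epsilon> x y1 y2 z :: real and p :: "real ^ 4"
  assumes eps: "\<epsilon> > 0" and p: "p = closest_point (Geps \<epsilon>) (vector [x, y1, y2, z])"
  defines "\<rho> \<equiv> p $ 1" and "m1 \<equiv> p $ 2" and "m2 \<equiv> p $ 3" and "E \<equiv> p $ 4"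
  defines "\<nu> \<equiv> E - z"
  defines "\<mu> \<equiv> \<rho> * (\<rho> - x) - \<nu> * ((m1\<^sup>2 + m2\<^sup>2) / (2 * \<rho>))"
  shows "\<rho> \<ge> \<epsilon>" and "E - (m1\<^sup>2 + m2\<^sup>2) / (2 * \<rho>) \<ge> \<epsilon>"
    and "\<nu> \<ge> 0" and "\<nu> = 0 \<or> E = \<epsilon> + (m1\<^sup>2 + m2\<^sup>2) / (2 * \<rho>)"
    and "\<rho> * (y1 - m1) = \<nu> * m1" and "\<rho> * (y2 - m2) = \<nu> * m2"
    and "\<mu> \<ge> 0" and "\<mu> = 0 \<or> \<rho> = \<epsilon>"
proof -
  define N where "N = (m1\<^sup>2 + m2\<^sup>2) / (2 * \<rho>)"
  have pG: "p \<in> Geps \<epsilon>" using closest_point_Geps_iff[OF eps] p by blast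
  have vi: "(x - \<rho>) * (r - \<rho>) + (y1 - m1) * (u - m1) + (y2 - m2) * (v - m2)
        - \<nu> * (e - E) \<le> 0"
    if "r \<ge> \<epsilon>" "e - (u\<^sup>2 + v\<^sup>2) / (2 * r) \<ge> \<epsilon>" for r u v e
  proof -
    have "vector [r, u, v, e] \<in> Geps \<epsilon>" using that by (simp add: Geps_def)
    then have "(vector [x, y1, y2, z] - p) \<bullet> (vector [r, u, v, e] - p) \<le> 0"
      using closest_point_dot[OF convex_Geps[OF eps] closed_Geps[OF eps]] p by blast
    moreover have "\<nu> * (e - E) = - ((z - E) * (e - E))" by (simp add: \<nu>_def algebra_simps)
    ultimately show ?thesis
      by (simp add: inner_real4 \<rho>_def m1_def m2_def E_def)
  qed
  show rho: "\<rho> \<ge> \<epsilon>" and en: "E - (m1\<^sup>2 + m2\<^sup>2) / (2 * \<rho>) \<ge> \<epsilon>"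
    using pG by (auto simp: Geps_def \<rho>_def m1_def m2_def E_def)
  then have rho0: "\<rho> > 0" using eps by linarith
  show lam: "\<nu> \<ge> 0" using vi[of \<rho> "E + 1" m1 m2] rho en by simp
  have "\<nu> * (E - (\<epsilon> + N)) \<le> 0"
    using vi[of \<rho> "\<epsilon> + N" m1 m2] rho by (simp add: N_def algebra_simps)
  with lam en have compl: "\<nu> * (E - (\<epsilon> + N)) = 0"
    by (smt (verit) N_def mult_nonneg_nonneg)
  then show "\<nu> = 0 \<or> E = \<epsilon> + (m1\<^sup>2 + m2\<^sup>2) / (2 * \<rho>)" by (auto simp: N_def)
  have "(y1 - m1) - \<nu> * m1 / \<rho> = 0"
  proof (rule linear_coeff_zero)
    fix t
    have "E + (m1 * t / \<rho> + t\<^sup>2 / (2 * \<rho>)) - ((m1 + t)\<^sup>2 + m2\<^sup>2) / (2 * \<rho>)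
        = E - (m1\<^sup>2 + m2\<^sup>2) / (2 * \<rho>)"
      using rho0 by (simp add: field_simps power2_eq_square)
    with vi[of \<rho> "E + (m1 * t / \<rho> + t\<^sup>2 / (2 * \<rho>))" "m1 + t" m2] rho en
    have "(y1 - m1) * t - \<nu> * (m1 * t / \<rho> + t\<^sup>2 / (2 * \<rho>)) \<le> 0" by simp
    then show "t * ((y1 - m1) - \<nu> * m1 / \<rho>) + t\<^sup>2 * (- \<nu> / (2 * \<rho>)) \<le> 0"
      by (simp add: algebra_simps)
  qed
  then show m1: "\<rho> * (y1 - m1) = \<nu> * m1" using rho0 by (simp add: field_simps)
  have "(y2 - m2) - \<nu> * m2 / \<rho> = 0"
  proof (rule linear_coeff_zero)
    fix t
    have "E + (m2 * t / \<rho> + t\<^sup>2 / (2 * \<rho>)) - (m1\<^sup>2 + (m2 + t)\<^sup>2) / (2 * \<rho>)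
        = E - (m1\<^sup>2 + m2\<^sup>2) / (2 * \<rho>)"
      using rho0 by (simp add: field_simps power2_eq_square)
    with vi[of \<rho> "E + (m2 * t / \<rho> + t\<^sup>2 / (2 * \<rho>))" m1 "m2 + t"] rho en
    have "(y2 - m2) * t - \<nu> * (m2 * t / \<rho> + t\<^sup>2 / (2 * \<rho>)) \<le> 0" by simp
    then show "t * ((y2 - m2) - \<nu> * m2 / \<rho>) + t\<^sup>2 * (- \<nu> / (2 * \<rho>)) \<le> 0"
      by (simp add: algebra_simps)
  qed
  then show m2: "\<rho> * (y2 - m2) = \<nu> * m2" using rho0 by (simp add: field_simps)
  have mu: "- t * \<mu> \<le> 0" if t: "\<rho> + t * \<rho> \<ge> \<epsilon>" for t
  proof -
    have "(1 + t) * \<rho> > 0" using t eps by (simp add: algebra_simps)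
    then have t1: "1 + t > 0" using rho0 by (simp add: zero_less_mult_iff)
    have "((m1 + t * m1)\<^sup>2 + (m2 + t * m2)\<^sup>2) / (2 * (\<rho> + t * \<rho>))
        = ((1 + t)\<^sup>2 * (m1\<^sup>2 + m2\<^sup>2)) / ((1 + t) * (2 * \<rho>))"
      by (simp add: algebra_simps power2_eq_square)
    also have "\<dots> = (1 + t) * N"
      using t1 rho0 by (simp add: N_def power2_eq_square)
    also have "\<dots> \<le> (1 + t) * (E - \<epsilon>)"
      using t1 en by (intro mult_left_mono) (auto simp: N_def)
    finally have "E + t * (E - \<epsilon>) - ((m1 + t * m1)\<^sup>2 + (m2 + t * m2)\<^sup>2) / (2 * (\<rho> + t * \<rho>)) \<ge> \<epsilon>"
      by (simp add: algebra_simps)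
    from vi[OF t this]
    have lin: "t * (\<rho> * (x - \<rho>) + (y1 - m1) * m1 + (y2 - m2) * m2 - \<nu> * (E - \<epsilon>)) \<le> 0"
      by (simp add: algebra_simps)
    have "(y1 - m1) * m1 + (y2 - m2) * m2 = 2 * (\<nu> * N)"
    proof -
      have "y1 - m1 = \<nu> * m1 / \<rho>" "y2 - m2 = \<nu> * m2 / \<rho>"
        using m1 m2 rho0 by (simp_all add: field_simps)
      then have "(y1 - m1) * m1 + (y2 - m2) * m2 = \<nu> * m1 / \<rho> * m1 + \<nu> * m2 / \<rho> * m2"
        by (simp only:)
      also have "\<dots> = 2 * (\<nu> * N)" using rho0 by (simp add: N_def field_simps power2_eq_square)
      finally show ?thesis .
    qed
    moreover have "\<nu> * (E - \<epsilon>) = \<nu> * N" using compl by (simp add: algebra_simps)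
    moreover have "\<mu> = \<rho> * (\<rho> - x) - \<nu> * N" by (simp add: \<mu>_def N_def)
    ultimately have "\<rho> * (x - \<rho>) + (y1 - m1) * m1 + (y2 - m2) * m2 - \<nu> * (E - \<epsilon>) = - \<mu>"
      by (simp only: add.assoc) (simp add: right_diff_distrib)
    with lin show ?thesis by simp
  qed
  show mu0: "\<mu> \<ge> 0" using mu[of 1] rho rho0 by simp
  show "\<mu> = 0 \<or> \<rho> = \<epsilon>"
  proof (rule disjCI)
    assume "\<rho> \<noteq> \<epsilon>"
    then have "(\<rho> - \<epsilon>) / \<rho> > 0" using rho rho0 by simp
    moreover have "(\<rho> - \<epsilon>) / \<rho> * \<mu> \<le> 0"
      using mu[of "- (\<rho> - \<epsilon>) / \<rho>"] rho0 by (simp add: field_simps)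
    ultimately show "\<mu> = 0" using mu0 by (smt (verit) mult_pos_pos)
  qed
qed

section \<open>The case of an inactive density constraint\<close>

text \<open>
  Elimination of \<open>m\<close>. With \<open>u = \<rho> / m\<close> the two stationarity conditions become
  \<open>x = m s - a y / (2u)\<close> and \<open>K = y (u - a / (2u))\<close>, where \<open>s = u + a / (2u)\<close> and \<open>K = \<epsilon> + x - z\<close>.
  Since \<open>(u - a / (2u))\<^sup>2 + 2a = s\<^sup>2\<close>, the radicand \<open>2y\<^sup>2 + K\<^sup>2 / a\<close> is the perfect square
  \<open>y\<^sup>2 s\<^sup>2 / a\<close>, and both sides of the claim equal \<open>2 y\<^sup>2 s\<^sup>2 m (y - m)\<close>.
\<close>

lemma density_quadratic:
  fixes \<epsilon> x y z a \<rho> m :: real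
  assumes "a > 0" "\<rho> > 0" "m \<noteq> 0"
    and mom: "\<rho> * (y - m) = (\<epsilon> + a * m\<^sup>2 / (2 * \<rho>) - z) * m"
    and dens: "2 * \<rho> * (\<rho> - x) = a * m * (y - m)"
  shows "4 * (2 * y\<^sup>2 + (\<epsilon> + x - z)\<^sup>2 / a) * (\<rho> * (\<rho> - x))
      = y\<^sup>2 * (2 * x * (\<epsilon> - z) + a * y\<^sup>2)"
proof -
  define u where "u = \<rho> / m"
  define s where "s = u + a / (2 * u)"
  have u: "u \<noteq> 0" and rho: "\<rho> = u * m" using assms by (auto simp: u_def)
  have "(\<rho> - x) * (2 * u * m) = a * (y - m) * m" using dens rho by (simp add: algebra_simps)
  then have d: "2 * u * (\<rho> - x) = a * (y - m)" using assms(3) by (simp add: mult_ac)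
  have x: "x = m * s - a * y / (2 * u)"
    using d u by (simp add: s_def rho field_simps)
  have "u * (y - m) * m = (\<epsilon> + a * m / (2 * u) - z) * m"
    using mom u assms(3) by (simp add: rho power2_eq_square)
  then have "u * (y - m) = \<epsilon> + a * m / (2 * u) - z" using assms(3) by simp
  then have ez: "\<epsilon> - z = y * u - m * s" by (simp add: s_def algebra_simps)
  have K: "\<epsilon> + x - z = y * (u - a / (2 * u))"
    using ez x by (simp add: algebra_simps)
  have S: "2 * y\<^sup>2 + (\<epsilon> + x - z)\<^sup>2 / a = y\<^sup>2 * s\<^sup>2 / a"
    unfolding K s_def using assms(1) u by (simp add: field_simps power2_eq_square)
  have r: "\<rho> * (\<rho> - x) = a * m * (y - m) / 2" using dens by simp
  have "4 * (2 * y\<^sup>2 + (\<epsilon> + x - z)\<^sup>2 / a) * (\<rho> * (\<rho> - x)) = y\<^sup>2 * (2 * s\<^sup>2 * m * (y - m))"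
    unfolding S r using assms(1) by (simp add: field_simps)
  also have "2 * s\<^sup>2 * m * (y - m) = 2 * (m * s) * y * s - 2 * (m * s)\<^sup>2"
    by (simp add: algebra_simps power2_eq_square)
  also have "\<dots> = 2 * x * (\<epsilon> - z) + a * y\<^sup>2"
  proof -
    have "2 * x * (\<epsilon> - z) + a * y\<^sup>2
        = 2 * (m * s) * y * (u + a / (2 * u)) - 2 * (m * s)\<^sup>2"
      unfolding x ez using u by (simp add: field_simps power2_eq_square)
    then show ?thesis by (simp add: s_def)
  qed
  finally show ?thesis .
qed

lemma coef_a_pos: "coef_a y1 y2 > 0"
  by (simp add: coef_a_def add_pos_nonneg)

text \<open>
  The quadratic for \<open>\<rho>\<close> turns the radicand \<open>R\<close> into \<open>(2\<rho> - x)\<^sup>2 S\<close>: it is nonnegative, and the quotient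
  of the two square roots is \<open>\<bar>2\<rho> - x\<bar>\<close>. The radicand for \<open>m\<close> below is a square in the same way.
\<close>

lemma rho_valuesI:
  assumes "y1 \<noteq> 0"
    and "4 * (2 * y1\<^sup>2 + (\<epsilon> + x - z)\<^sup>2 / coef_a y1 y2) * (\<rho> * (\<rho> - x))
      = y1\<^sup>2 * (2 * x * (\<epsilon> - z) + coef_a y1 y2 * y1\<^sup>2)"
  shows "\<rho> \<in> rho_values \<epsilon> x y1 y2 z"
proof -
  define a where "a = coef_a y1 y2"
  define S where "S = 2 * y1\<^sup>2 + 1 / a * (\<epsilon> + x - z)\<^sup>2"
  define R where "R = x\<^sup>2 * S - 2 * x * y1\<^sup>2 * (z - \<epsilon>) + a * y1 ^ 4"
  have a: "a > 0" by (simp add: a_def coef_a_pos)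
  then have S: "S > 0" using assms(1) by (simp add: S_def add_pos_nonneg)
  have "4 * S * (\<rho> * (\<rho> - x)) = y1\<^sup>2 * (2 * x * (\<epsilon> - z) + a * y1\<^sup>2)"
    using assms(2) by (simp add: S_def a_def)
  then have R: "R = (2 * \<rho> - x)\<^sup>2 * S"
    by (simp add: R_def algebra_simps power2_eq_square power4_eq_xxxx)
  then have "sqrt R = \<bar>2 * \<rho> - x\<bar> * sqrt S" by (simp add: real_sqrt_mult)
  then have "sqrt R / sqrt S = \<bar>2 * \<rho> - x\<bar>" using S by simp
  moreover have "R \<ge> 0" using R S by simp
  ultimately show ?thesis
    unfolding rho_values_def Let_def a_def[symmetric] S_def[symmetric] R_def[symmetric]
    by (auto simp: abs_if field_simps)
qed

lemma m1_valuesI: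
  assumes dens: "2 * \<rho> * (\<rho> - x) = coef_a y1 y2 * m * (y1 - m)"
  shows "m \<in> m1_values x y1 y2 \<rho>"
proof -
  define a where "a = coef_a y1 y2"
  define D where "D = - 8 * a * \<rho>\<^sup>2 + 8 * a * x * \<rho> + a\<^sup>2 * y1\<^sup>2"
  have a: "a > 0" by (simp add: a_def coef_a_pos)
  have "D = a\<^sup>2 * y1\<^sup>2 - 4 * a * (2 * \<rho> * (\<rho> - x))"
    by (simp add: D_def algebra_simps power2_eq_square)
  also have "\<dots> = (a * (2 * m - y1))\<^sup>2"
    unfolding dens a_def[symmetric] by (simp add: algebra_simps power2_eq_square)
  finally have D: "D = (a * (2 * m - y1))\<^sup>2" .
  then have "sqrt D = a * \<bar>2 * m - y1\<bar>" using a by (simp add: abs_mult)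
  then have "1 / (2 * a) * sqrt D = \<bar>2 * m - y1\<bar> / 2" using a by simp
  moreover have "D \<ge> 0" using D by simp
  ultimately show ?thesis
    unfolding m1_values_def Let_def a_def[symmetric] D_def[symmetric]
    by (auto simp: abs_if field_simps)
qed

section \<open>Candidates and the projection\<close>

lemma coef_a_norm:
  assumes "y1 \<noteq> 0"
  shows "m\<^sup>2 + (y2 / y1 * m)\<^sup>2 = coef_a y1 y2 * m\<^sup>2"
  using assms by (simp add: coef_a_def field_simps)

lemma candidates_subset_Geps:
  assumes "\<epsilon> > 0"
  shows "candidates \<epsilon> x y1 y2 z \<subseteq> Geps \<epsilon>"
proof -
  have "cand1 \<epsilon> x y1 y2 z \<subseteq> Geps \<epsilon>" by (auto simp: cand1_def Geps_def)
  moreover have "cand2 \<epsilon> x y1 y2 z \<subseteq> Geps \<epsilon>" by (auto simp: cand2_def Geps_def)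
  moreover have "coef_a y1 y2 / (2 * \<epsilon>) * m\<^sup>2 = coef_a y1 y2 * m\<^sup>2 / (2 * \<epsilon>)" for m
    by simp
  then have "cand3 \<epsilon> x y1 y2 z \<subseteq> Geps \<epsilon>"
    by (auto simp: cand3_def Geps_def Let_def coef_a_norm simp del: times_divide_eq_left)
  moreover have "cand4 \<epsilon> x y1 y2 z \<subseteq> Geps \<epsilon>" by (auto simp: cand4_def Geps_def)
  moreover have "cand5 \<epsilon> x y1 y2 z \<subseteq> Geps \<epsilon>"
    by (auto simp: cand5_def Geps_def Let_def coef_a_norm simp del: times_divide_eq_left)
  ultimately show ?thesis by (auto simp: candidates_def)
qed

lemma projection_in_candidates:
  assumes eps: "\<epsilon> > 0" and out: "vector [x, y1, y2, z] \<notin> Geps \<epsilon>"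
    and y: "\<bar>y1\<bar> \<ge> \<bar>y2\<bar>"
    and p: "p = closest_point (Geps \<epsilon>) (vector [x, y1, y2, z])"
  shows "p \<in> candidates \<epsilon> x y1 y2 z"
proof -
  define \<rho> m1 m2 E where "\<rho> = p $ 1" and "m1 = p $ 2" and "m2 = p $ 3" and "E = p $ 4"
  define \<nu> where "\<nu> = E - z"
  define \<mu> where "\<mu> = \<rho> * (\<rho> - x) - \<nu> * ((m1\<^sup>2 + m2\<^sup>2) / (2 * \<rho>))"
  note kkt = projection_kkt[OF eps p,
      folded \<rho>_def m1_def m2_def E_def, folded \<nu>_def, folded \<mu>_def]
  have pv: "p = vector [\<rho>, m1, m2, E]"
    by (simp add: vec_eq_iff forall_4 \<rho>_def m1_def m2_def E_def)
  have rho0: "\<rho> > 0" using kkt(1) eps by linarith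
  define a where "a = coef_a y1 y2"
  have colinear: "m1 \<noteq> 0" "m2 = y2 / y1 * m1" "E = \<epsilon> + a * m1\<^sup>2 / (2 * \<rho>)"
    "2 * \<mu> = 2 * \<rho> * (\<rho> - x) - a * m1 * (y1 - m1)" if "\<nu> > 0" "y1 \<noteq> 0"
  proof -
    have e: "(\<rho> + \<nu>) * m1 = \<rho> * y1" "(\<rho> + \<nu>) * m2 = \<rho> * y2"
      using kkt(5,6) by (simp_all add: algebra_simps)
    then show m1: "m1 \<noteq> 0" using that rho0 by auto
    have "(\<rho> + \<nu>) * (m2 * y1) = (\<rho> + \<nu>) * (y2 * m1)"
      using e by (metis mult.assoc mult.commute)
    then have "m2 * y1 = y2 * m1" using that rho0 by simp
    then show m2: "m2 = y2 / y1 * m1" using that by (simp add: field_simps)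
    have n: "m1\<^sup>2 + m2\<^sup>2 = a * m1\<^sup>2" unfolding m2 a_def by (rule coef_a_norm[OF that(2)])
    show "E = \<epsilon> + a * m1\<^sup>2 / (2 * \<rho>)" using kkt(4) that n by simp
    have "\<nu> * (m1\<^sup>2 + m2\<^sup>2) / \<rho> = a * m1 * (\<nu> * m1) / \<rho>"
      unfolding n by (simp add: power2_eq_square)
    also have "\<dots> = a * m1 * (y1 - m1)" unfolding kkt(5)[symmetric] using rho0 by simp
    finally have "\<nu> * (m1\<^sup>2 + m2\<^sup>2) / \<rho> = a * m1 * (y1 - m1)" .
    moreover have "2 * \<mu> = 2 * \<rho> * (\<rho> - x) - \<nu> * (m1\<^sup>2 + m2\<^sup>2) / \<rho>"
      by (simp add: \<mu>_def right_diff_distrib)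
    ultimately show "2 * \<mu> = 2 * \<rho> * (\<rho> - x) - a * m1 * (y1 - m1)" by (simp only:)
  qed
  consider "\<nu> = 0" | "\<nu> > 0" "y1 = 0" | "\<nu> > 0" "y1 \<noteq> 0" "\<mu> > 0"
    | "\<nu> > 0" "y1 \<noteq> 0" "\<mu> = 0"
    using kkt(3,7) by linarith
  then show ?thesis
  proof cases
    case 1
    then have m: "m1 = y1" "m2 = y2" "E = z" using kkt(5,6) rho0 by (auto simp: \<nu>_def)
    have ne: "\<rho> \<noteq> x" using out pv m kkt(1,2) by (auto simp: Geps_def)
    have "\<mu> = \<rho> * (\<rho> - x)" using 1 by (simp add: \<mu>_def)
    then have "\<rho> = \<epsilon>" "\<rho> > x"
      using kkt(7,8) rho0 ne by (auto simp: zero_le_mult_iff)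
    then have "p \<in> cand1 \<epsilon> x y1 y2 z" using pv m kkt(2) by (simp add: cand1_def)
    then show ?thesis by (simp add: candidates_def)
  next
    case 2
    then have y0: "y1 = 0" "y2 = 0" using y by auto
    have "(\<rho> + \<nu>) * m1 = 0" "(\<rho> + \<nu>) * m2 = 0"
      using kkt(5,6) y0 by (simp_all add: algebra_simps)
    then have m: "m1 = 0" "m2 = 0" using 2 rho0 by auto
    then have E: "E = \<epsilon>" "z < \<epsilon>" using kkt(4) 2 by (auto simp: \<nu>_def)
    have mu: "\<mu> = \<rho> * (\<rho> - x)" using m by (simp add: \<mu>_def)
    show ?thesis
    proof (cases "\<rho> = x")
      case True
      then have "p \<in> cand4 \<epsilon> x y1 y2 z" using pv m E y0 kkt(1) by (simp add: cand4_def)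
      then show ?thesis by (simp add: candidates_def)
    next
      case False
      then have "\<rho> = \<epsilon>" "\<rho> > x" using kkt(7,8) rho0 mu by (auto simp: zero_le_mult_iff)
      then have "p \<in> cand2 \<epsilon> x y1 y2 z" using pv m E y0 by (simp add: cand2_def)
      then show ?thesis by (simp add: candidates_def)
    qed
  next
    case 3
    have r: "\<rho> = \<epsilon>" using kkt(8) 3 by simp
    note * = colinear[OF 3(1,2)]
    have lam: "\<nu> = \<epsilon> + a * m1\<^sup>2 / (2 * \<epsilon>) - z" using * r by (simp add: \<nu>_def)
    have st: "\<epsilon> * (y1 - m1) = \<nu> * m1" using kkt(5) r by simp
    have "2 * \<epsilon> * (\<epsilon> * (y1 - m1)) = 2 * \<epsilon> * (\<epsilon> + a * m1\<^sup>2 / (2 * \<epsilon>) - z) * m1"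
      using st lam by simp
    also have "\<dots> = (2 * \<epsilon>\<^sup>2 + a * m1\<^sup>2 - 2 * \<epsilon> * z) * m1"
      using eps by (simp add: field_simps power2_eq_square)
    finally have cubic: "a * m1 ^ 3 + (4 * \<epsilon>\<^sup>2 - 2 * \<epsilon> * z) * m1 - 2 * \<epsilon>\<^sup>2 * y1 = 0"
      by (simp add: algebra_simps power2_eq_square power3_eq_cube)
    have "y1 / m1 = 1 + \<nu> / \<epsilon>" using st eps *(1) by (simp add: field_simps)
    then have gt: "y1 / m1 > 1" using 3 eps by simp
    have "2 * \<mu> = 2 * \<epsilon> * (\<epsilon> - x) - a * m1 * (y1 - m1)"
      using *(4) r by simp
    then have "2 * \<epsilon> * x + a * m1 * (y1 - m1) < 2 * \<epsilon>\<^sup>2"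
      using 3(3) by (simp add: algebra_simps power2_eq_square)
    moreover have "p = vector [\<epsilon>, m1, y2 / y1 * m1, a / (2 * \<epsilon>) * m1\<^sup>2 + \<epsilon>]"
      using pv r *(2,3) by (simp add: add.commute)
    ultimately have "p \<in> cand3 \<epsilon> x y1 y2 z"
      using 3(2) cubic gt unfolding cand3_def Let_def a_def[symmetric] by blast
    then show ?thesis by (simp add: candidates_def)
  next
    case 4
    note * = colinear[OF 4(1,2)]
    have dens: "2 * \<rho> * (\<rho> - x) = a * m1 * (y1 - m1)" using *(4) 4 by simp
    have "\<rho> * (y1 - m1) = (\<epsilon> + a * m1\<^sup>2 / (2 * \<rho>) - z) * m1"
      using kkt(5) *(3) by (simp add: \<nu>_def)
    from density_quadratic[OF _ rho0 *(1) this dens]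
    have "\<rho> \<in> rho_values \<epsilon> x y1 y2 z"
      using 4(2) by (intro rho_valuesI) (auto simp: a_def coef_a_pos)
    moreover have "m1 \<in> m1_values x y1 y2 \<rho>"
      using dens unfolding a_def by (rule m1_valuesI)
    moreover have "\<epsilon> + a * (m1\<^sup>2 / (2 * \<rho>)) > z" using *(3) 4(1) by (simp add: \<nu>_def)
    moreover have "p = vector [\<rho>, m1, y2 / y1 * m1, \<epsilon> + a * (m1\<^sup>2 / (2 * \<rho>))]"
      using pv *(2,3) by simp
    ultimately have "p \<in> cand5 \<epsilon> x y1 y2 z"
      using 4(2) kkt(1) unfolding cand5_def Let_def a_def[symmetric] by blast
    then show ?thesis by (simp add: candidates_def)
  qed
qed

theorem mainTheorem3:
  fixes \<epsilon> x y1 y2 z :: real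
  assumes "\<epsilon> > 0"
    and "vector [x, y1, y2, z] \<notin> Geps \<epsilon>"
    and "\<bar>y1\<bar> \<ge> \<bar>y2\<bar>"
  defines "C \<equiv> candidates \<epsilon> x y1 y2 z"
    and "objective \<equiv> \<lambda>p :: real ^ 4.
           \<bar>p $ 1 - x\<bar>\<^sup>2 + \<bar>p $ 2 - y1\<bar>\<^sup>2 + \<bar>p $ 3 - y2\<bar>\<^sup>2 + \<bar>p $ 4 - z\<bar>\<^sup>2"
  shows "(\<exists>p. is_arg_min objective (\<lambda>p. p \<in> C) p) \<and>
         (\<forall>p. is_arg_min objective (\<lambda>p. p \<in> C) p \<longrightarrow>
              p = closest_point (Geps \<epsilon>) (vector [x, y1, y2, z]))"
proof -
  define w :: "real ^ 4" where "w = vector [x, y1, y2, z]"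
  define c where "c = closest_point (Geps \<epsilon>) w"
  have obj: "objective p \<le> objective q \<longleftrightarrow> dist w p \<le> dist w q" for p q
  proof -
    have "objective r = (dist w r)\<^sup>2" for r
      unfolding objective_def dist_norm power2_norm_eq_inner inner_real4
      by (simp add: w_def power2_eq_square algebra_simps)
    then show ?thesis by simp
  qed
  have CG: "C \<subseteq> Geps \<epsilon>" unfolding C_def by (rule candidates_subset_Geps[OF assms(1)])
  have cC: "c \<in> C"
    unfolding C_def by (rule projection_in_candidates[OF assms(1-3)]) (simp add: c_def w_def)
  have cmin: "objective c \<le> objective q" if "q \<in> Geps \<epsilon>" for q
    using closest_point_Geps_iff[OF assms(1), of c w] that obj by (simp add: c_def)
  have "is_arg_min objective (\<lambda>p. p \<in> C) c"
    using cC CG cmin by (auto simp: is_arg_min_def not_less)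
  moreover have "p = c" if "is_arg_min objective (\<lambda>p. p \<in> C) p" for p
  proof -
    have "p \<in> C" "objective p \<le> objective c" using that cC by (auto simp: is_arg_min_def not_less)
    then have "p \<in> Geps \<epsilon> \<and> (\<forall>q\<in>Geps \<epsilon>. dist w p \<le> dist w q)"
      using CG cmin obj by (meson order_trans subsetD)
    then show ?thesis unfolding c_def closest_point_Geps_iff[OF assms(1), symmetric] .
  qed
  ultimately show ?thesis unfolding c_def w_def by blast
qed

end
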